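(* Let $A\subset\mathbb{R}$ be a nowhere dense compact perfect set of positive Lebesgue measure. Then there exists a compact perfect set $B\subset\mathbb{R}$ such that $N+B\neq A+B$ for every closed null subset $N$ of $A$.
   Context: A set is null if its Lebesgue measure is $0$. A set is perfect if it is closed and has no isolated points. For $E,F\subset\mathbb{R}$, $E+F=\{e+f : e\in E,\ f\in F\}$. *)

theory Defs
  imports "HOL-Analysis.Analysis" "HOL-Library.Set_Algebras"
begin

definition nowhere_dense :: "'a::topological_space set \<Rightarrow> bool"
  where "nowhere_dense S \<longleftrightarrow> interior (closure S) = {}"

text \<open>The empty set counts as perfect.\<close>

definition perfect_set :: "'a::topological_space set \<Rightarrow> bool"
  where "perfect_set S \<longleftrightarrow> closed S \<and> (\<nexists>x. x isolated_in S)"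

end

theory Submission
  imports Defs
begin

text \<open>
  Let \<open>D\<close> be a countable dense subset of \<open>A\<close>. If \<open>B\<close> contains \<open>0\<close> and no nonzero point of the
  meagre set \<open>\<Union>d\<in>D. d - A\<close>, then \<open>d = d + 0\<close> is the only representation of \<open>d \<in> D\<close> as an element
  of \<open>A + B\<close>. Hence \<open>N + B = A + B\<close> with \<open>N \<subseteq> A\<close> forces \<open>D \<subseteq> N\<close>, and so \<open>A \<subseteq> N\<close> when \<open>N\<close>
  is closed. A compact perfect \<open>B\<close> of this kind is obtained as the closure of the set of finite
  subsums of a rapidly decreasing sequence.
\<close>

lemma not_isolated_in_closure:
  fixes S :: "'a::metric_space set"
  assumes "\<And>s. s \<in> S \<Longrightarrow> s islimpt S"
  shows "\<not> x isolated_in closure S"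
proof
  assume x: "x isolated_in closure S"
  then have "x \<in> closure S" "\<not> x islimpt closure S"
    by (auto simp: isolated_in_islimpt_iff)
  then show False
    using assms unfolding limpt_of_closure by (auto simp: closure_def)
qed

text \<open>By Baire: the forbidden \<open>t\<close> form a countable union of the translates
  \<open>M n - s\<close>, closed with empty interior, so the admissible ones are dense and in
  particular come arbitrarily close to 0.\<close>

lemma small_vector_avoiding_meagre:
  fixes M :: "nat \<Rightarrow> 'a::euclidean_space set"
  assumes closed: "\<And>n. closed (M n)" and int: "\<And>n. interior (M n) = {}"
    and S: "finite S" and r: "0 < r"
  obtains t where "t \<noteq> 0" "norm t < r" "\<And>s n. s \<in> S \<Longrightarrow> s + t \<notin> M n"
proof -
  \<comment> \<open>The member \<open>- {0}\<close> is what makes \<open>t\<close> nonzero.\<close>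
  define U where "U = insert (- {0}) ((\<lambda>(s, n). - ((\<lambda>x. x - s) ` M n)) ` (S \<times> UNIV))"
  have "open V \<and> closure V = UNIV" if "V \<in> U" for V
    using that closed int
    by (auto simp: U_def closure_complement interior_translation_subtract
        intro!: closed_translation_subtract)
  moreover have "countable U"
    using S by (auto simp: U_def countable_finite)
  ultimately have "UNIV \<subseteq> closure (\<Inter>U)"
    by (intro Baire) auto
  then obtain t where t: "t \<in> \<Inter>U" "dist t 0 < r"
    using r by (metis UNIV_I closure_approachable subsetD)
  show thesis
  proof
    show "t \<noteq> 0" "norm t < r"
      using t by (auto simp: U_def)
    show "s + t \<notin> M n" if "s \<in> S" for s n
    proof
      assume "s + t \<in> M n"
      then have "t \<in> (\<lambda>x. x - s) ` M n"
        by (intro image_eqI[of _ _ "s + t"]) auto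
      then show False
        using t(1) that by (auto simp: U_def)
    qed
  qed
qed

lemma uniform_gap:
  fixes S :: "'a::metric_space set"
  assumes "finite S" "finite I" "0 < r"
    and "\<And>i. i \<in> I \<Longrightarrow> closed (M i)" "\<And>s i. s \<in> S \<Longrightarrow> i \<in> I \<Longrightarrow> s \<notin> M i"
  obtains e where "0 < e" "e \<le> r" "\<And>s i. s \<in> S \<Longrightarrow> i \<in> I \<Longrightarrow> cball s e \<inter> M i = {}"
proof -
  have "\<exists>e>0. cball s e \<subseteq> - (\<Union>i\<in>I. M i)" if "s \<in> S" for s
  proof -
    have "open (- (\<Union>i\<in>I. M i))"
      using assms by (auto intro: closed_UN)
    then show ?thesis
      using assms that open_contains_cball by (metis ComplI UN_E)
  qed
  then obtain e where e: "\<And>s. s \<in> S \<Longrightarrow> 0 < e s \<and> cball s (e s) \<subseteq> - (\<Union>i\<in>I. M i)"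
    by metis
  \<comment> \<open>Inserting \<open>r\<close> enforces the cap and keeps \<open>Min\<close>
    meaningful when \<open>S\<close> is empty.\<close>
  define e' where "e' = Min (insert r (e ` S))"
  show thesis
  proof
    show "0 < e'" "e' \<le> r"
      using assms(1,3) e by (auto simp: e'_def)
    fix s i assume "s \<in> S" "i \<in> I"
    moreover from this have "e' \<le> e s"
      using assms(1) by (auto simp: e'_def)
    ultimately show "cball s e' \<inter> M i = {}"
      using e subset_cball by blast
  qed
qed

text \<open>At stage \<open>k\<close> every point \<open>s\<close> of a finite set gains a companion
  \<open>s + t\<close> within a small ball. Balls around nonzero points are kept clear of
  \<open>M n\<close> for all \<open>n < k\<close>; the ball around 0 is uncontrolled but shrinks to
  0. The closure of all points is the required set.\<close>

lemma perfect_set_avoiding_meagre: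
  fixes M :: "nat \<Rightarrow> 'a::euclidean_space set"
  assumes closed: "\<And>n. closed (M n)" and int: "\<And>n. interior (M n) = {}"
  obtains B where "compact B" "perfect_set B" "0 \<in> B" "\<And>x n. x \<in> B \<Longrightarrow> x \<noteq> 0 \<Longrightarrow> x \<notin> M n"
proof -
  \<comment> \<open>The points avoid every \<open>M n\<close>, which lets each later stage find a
    positive gap from one more \<open>M n\<close>; whole balls can avoid only finitely many at a
    time.\<close>
  define P where "P k p = (case p of (S, r) \<Rightarrow> finite S \<and> 0 \<in> S \<and> 0 < r \<and> r \<le> (1/2)^k \<and>
      (\<forall>s\<in>S - {0}. \<forall>n. s \<notin> M n) \<and> (\<forall>s\<in>S - {0}. \<forall>n<k. cball s r \<inter> M n = {}))"
    for k :: nat and p :: "'a set \<times> real"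
  \<comment> \<open>Nested balls confine the limit set to each stage; the nearby new points make
    every point a limit point.\<close>
  define Q where "Q p p' = (case p of (S, r) \<Rightarrow> case p' of (S', r') \<Rightarrow> S \<subseteq> S' \<and>
      (\<forall>s'\<in>S'. \<exists>s\<in>S. cball s' r' \<subseteq> cball s r) \<and> (\<forall>s\<in>S. \<exists>s'\<in>S'. s' \<noteq> s \<and> dist s' s \<le> r))"
    for p p' :: "'a set \<times> real"
  have "\<exists>f. \<forall>k. P k (f k) \<and> Q (f k) (f (Suc k))"
  proof (rule dependent_nat_choice)
    show "\<exists>p. P 0 p"
      by (rule exI[of _ "({0}, 1)"]) (auto simp: P_def)
    fix p k assume "P k p"
    obtain S r where p: "p = (S, r)"
      by (cases p)
    have S: "finite S" "0 \<in> S" "0 < r" "r \<le> (1/2)^k" "\<And>s n. s \<in> S \<Longrightarrow> s \<noteq> 0 \<Longrightarrow> s \<notin> M n"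
      using \<open>P k p\<close> by (auto simp: P_def p)
    \<comment> \<open>Since 0 lies in \<open>S\<close>, this also keeps \<open>t\<close> itself
      outside every \<open>M n\<close>. With \<open>norm t < r / 2\<close> and the later
      \<open>r' \<le> r / 2\<close>, the new balls fit inside the old ones.\<close>
    obtain t where t: "t \<noteq> 0" "norm t < r / 2" "\<And>s n. s \<in> S \<Longrightarrow> s + t \<notin> M n"
      by (rule small_vector_avoiding_meagre[of M S "r / 2"]) (use closed int S in auto)
    define S' where "S' = S \<union> (\<lambda>s. s + t) ` S"
    have S': "s \<notin> M n" if "s \<in> S' - {0}" for s n
      using that S(5) t(3) by (auto simp: S'_def)
    obtain r' where r': "0 < r'" "r' \<le> r / 2"
      "\<And>s n. s \<in> S' - {0} \<Longrightarrow> n \<in> {..<Suc k} \<Longrightarrow> cball s r' \<inter> M n = {}"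
      by (rule uniform_gap[of "S' - {0}" "{..<Suc k}" "r / 2" M])
        (use S S' closed in \<open>auto simp: S'_def\<close>)
    have "P (Suc k) (S', r')"
      using S S' r' by (auto simp: P_def S'_def)
    moreover have "\<exists>s\<in>S. cball s' r' \<subseteq> cball s r" if "s' \<in> S'" for s'
    proof -
      obtain s where s: "s \<in> S" "s' = s \<or> s' = s + t"
        using \<open>s' \<in> S'\<close> by (auto simp: S'_def)
      then have "dist s' s \<le> r / 2"
        using t(2) S(3) by (auto simp: dist_norm)
      then have "cball s' r' \<subseteq> cball s r"
        using r'(2) by (simp add: cball_subset_cball_iff)
      then show ?thesis
        using s(1) by blast
    qed
    moreover have "\<exists>s'\<in>S'. s' \<noteq> s \<and> dist s' s \<le> r" if "s \<in> S" for s
      using that t(1,2) S(3) by (intro bexI[of _ "s + t"]) (auto simp: S'_def dist_norm)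
    ultimately show "\<exists>p'. P (Suc k) p' \<and> Q p p'"
      by (intro exI[of _ "(S', r')"]) (auto simp: Q_def p S'_def)
  qed
  then obtain f where f: "\<And>k. P k (f k)" "\<And>k. Q (f k) (f (Suc k))"
    by blast
  define S where "S k = fst (f k)" for k
  define r where "r k = snd (f k)" for k
  have S: "finite (S k)" "0 \<in> S k" "0 < r k" "r k \<le> (1/2)^k" for k
    using f(1)[of k] by (auto simp: P_def S_def r_def split: prod.splits)
  have gap: "cball s (r k) \<inter> M n = {}" if "s \<in> S k" "s \<noteq> 0" "n < k" for s k n
    using f(1)[of k] that by (auto simp: P_def S_def r_def split: prod.splits)
  have S_Suc: "S k \<subseteq> S (Suc k)"
    and nested: "\<And>s'. s' \<in> S (Suc k) \<Longrightarrow> \<exists>s\<in>S k. cball s' (r (Suc k)) \<subseteq> cball s (r k)"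
    and near: "\<And>s. s \<in> S k \<Longrightarrow> \<exists>s'\<in>S (Suc k). s' \<noteq> s \<and> dist s' s \<le> r k" for k
    using f(2)[of k] by (auto simp: Q_def S_def r_def split: prod.splits)
  \<comment> \<open>As decreasing finite unions of closed balls, the \<open>K k\<close> all contain
    \<open>closure T\<close>, so each point of \<open>closure T\<close> is within \<open>r k\<close>
    of \<open>S k\<close>.\<close>
  define K where "K k = (\<Union>s\<in>S k. cball s (r k))" for k
  have S_mono: "S j \<subseteq> S k" if "j \<le> k" for j k
    using lift_Suc_mono_le[of S, OF S_Suc that] .
  have "K (Suc k) \<subseteq> K k" for k
    using nested by (fastforce simp: K_def)
  then have K_anti: "K k \<subseteq> K j" if "j \<le> k" for j k
    using lift_Suc_antimono_le[of K] that by blast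
  have S_K: "S k \<subseteq> K k" for k
    using S(3)[of k] by (force simp: K_def)
  define T where "T = (\<Union>k. S k)"
  have T_K: "closure T \<subseteq> K k" for k
  proof (rule closure_minimal)
    show "closed (K k)"
      using S(1) by (auto simp: K_def)
    show "T \<subseteq> K k"
      unfolding T_def using S_mono S_K K_anti by (meson UN_least nat_le_linear order_trans)
  qed
  have small: "\<exists>k\<ge>m. r k < e" if e: "0 < e" for e m
  proof -
    obtain k where "(1/2::real)^k < e"
      using real_arch_pow_inv[OF e, of "1/2"] by auto
    moreover have "r (max k m) \<le> (1/2)^k"
      by (rule order_trans[OF S(4)]) (auto intro: power_decreasing)
    ultimately show ?thesis
      by (intro exI[of _ "max k m"]) auto
  qed
  show thesis
  proof
    have "bounded (K 0)"
      using S(1) by (auto simp: K_def)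
    then show "compact (closure T)"
      using T_K bounded_subset compact_eq_bounded_closed closed_closure by metis
    have "s islimpt T" if "s \<in> T" for s
      unfolding islimpt_approachable
    proof (intro allI impI)
      fix e :: real assume "0 < e"
      obtain m where "s \<in> S m"
        using \<open>s \<in> T\<close> by (auto simp: T_def)
      moreover obtain k where "m \<le> k" "r k < e"
        using small[OF \<open>0 < e\<close>] by blast
      ultimately obtain s' where "s' \<in> S (Suc k)" "s' \<noteq> s" "dist s' s < e"
        using near[of s k] S_mono[of m k] by fastforce
      then show "\<exists>s'\<in>T. s' \<noteq> s \<and> dist s' s < e"
        by (auto simp: T_def)
    qed
    then show "perfect_set (closure T)"
      by (simp add: perfect_set_def not_isolated_in_closure)
    show "0 \<in> closure T"
      using S(2)[of 0] closure_subset[of T] by (auto simp: T_def)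
    fix x n assume x: "x \<in> closure T" "x \<noteq> 0"
    \<comment> \<open>The bound \<open>r k < norm x\<close> rules out 0 as the centre of a ball
      containing \<open>x\<close>, and \<open>n < k\<close> makes the gap from \<open>M n\<close>
      available.\<close>
    obtain k where k: "Suc n \<le> k" "r k < norm x"
      using small[of "norm x"] x(2) by auto
    obtain s where s: "s \<in> S k" "x \<in> cball s (r k)"
      using T_K[of k] x(1) by (auto simp: K_def)
    then have "s \<noteq> 0"
      using k(2) by auto
    then show "x \<notin> M n"
      using gap[OF s(1), of n] k(1) s(2) by auto
  qed
qed

text \<open>The reflection is a continuous involution, so the preimage of an interior is an open
  subset of \<open>A\<close>.\<close>

lemma interior_reflect_empty:
  fixes A :: "'a::real_normed_vector set"
  assumes "interior A = {}"
  shows "interior ((\<lambda>x. d - x) ` A) = {}"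
proof -
  let ?U = "(\<lambda>x. d - x) -` interior ((\<lambda>x. d - x) ` A)"
  have "open ?U"
    by (intro open_vimage continuous_intros) auto
  moreover have "?U \<subseteq> A"
  proof
    fix x assume "x \<in> ?U"
    then have "d - x \<in> (\<lambda>x. d - x) ` A"
      using interior_subset by (metis subsetD vimageD)
    then show "x \<in> A"
      by auto
  qed
  ultimately have "?U = {}"
    using assms interior_maximal by blast
  moreover have "d - (d - x) = x" for x
    by simp
  ultimately show ?thesis
    by (metis empty_iff equals0I vimageI)
qed

theorem theorem3p1:
  fixes A :: "real set"
  assumes "nowhere_dense A" and "compact A" and "perfect_set A"
    and "emeasure lebesgue A > 0"
  shows "\<exists>B :: real set. compact B \<and> perfect_set B \<and>
    (\<forall>N. N \<subseteq> A \<and> closed N \<and> N \<in> null_sets lebesgue \<longrightarrow> N + B \<noteq> A + B)"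
proof -
  obtain D where D: "countable D" "D \<subseteq> A" "A \<subseteq> closure D"
    using separable by blast
  have "D \<noteq> {}"
    using D(3) assms(4) by auto
  \<comment> \<open>\<open>M n\<close> collects the differences \<open>d - x\<close> with
    \<open>x\<close> in \<open>A\<close>, for the \<open>n\<close>-th point \<open>d\<close> of
    \<open>D\<close>: exactly the \<open>b\<close> for which \<open>d = x + b\<close>.\<close>
  define M where "M n = (\<lambda>x. from_nat_into D n - x) ` A" for n
  have "compact (M n)" for n
    unfolding M_def using assms(2) by (intro compact_continuous_image continuous_intros)
  moreover have "interior A = {}"
    using assms(1,2) by (simp add: nowhere_dense_def compact_imp_closed)
  then have "interior (M n) = {}" for n
    unfolding M_def by (rule interior_reflect_empty)
  ultimately have "\<And>n. closed (M n)" "\<And>n. interior (M n) = {}"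
    by (auto intro: compact_imp_closed)
  then obtain B where B: "compact B" "perfect_set B" "0 \<in> B"
      "\<And>x n. x \<in> B \<Longrightarrow> x \<noteq> 0 \<Longrightarrow> x \<notin> M n"
    using perfect_set_avoiding_meagre[of M] by metis
  have "N + B \<noteq> A + B" if N: "N \<subseteq> A" "closed N" "N \<in> null_sets lebesgue" for N
  proof
    assume eq: "N + B = A + B"
    have "D \<subseteq> N"
    proof
      fix d assume d: "d \<in> D"
      then have "d + 0 \<in> N + B"
        unfolding eq using D(2) B(3) by (intro set_plus_intro) auto
      then obtain x b where xb: "d = x + b" "x \<in> N" "b \<in> B"
        by (auto simp: set_plus_def)
      obtain n where "d = from_nat_into D n"
        using from_nat_into_surj[OF D(1) d] by metis
      then have "b \<in> M n"
        unfolding M_def using xb N(1) by (intro image_eqI[of _ _ x]) auto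
      then show "d \<in> N"
        \<comment> \<open>A nonzero \<open>b\<close> in \<open>B\<close> would avoid
          \<open>M n\<close>; hence \<open>b = 0\<close> and \<open>d = x\<close> lies in
          \<open>N\<close>.\<close>
        using B(4)[of b n] xb by (cases "b = 0") auto
    qed
    then have "A \<subseteq> N"
      using D(3) closure_minimal N(2) by blast
    \<comment> \<open>Now \<open>N = A\<close>, so a null set would have positive measure.\<close>
    then show False
      using N(1,3) assms(4) by auto
  qed
  then show ?thesis
    using B(1,2) by blast
qed

end
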